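(* For every $p\in(0,1]$ there is no finite constant $K(p)$, depending only on $p$, such that $$\int_C |f(z)|^p\,|dz|\le K(p)\int_{\mathbb{T}}|f(z)|^p\,|dz|$$ holds for every $f\in h^p$ (having radial limits almost everywhere on $\mathbb{T}$) and every convex curve $C$ in $\mathbb{D}$.
   Context: $\mathbb{D}=\{z\in\mathbb{C}:|z|<1\}$ and $\mathbb{T}=\{z\in\mathbb{C}:|z|=1\}$. A complex-valued function $f=u+iv$ is harmonic in $\mathbb{D}$ if $u,v$ are real-valued harmonic functions in $\mathbb{D}$. For $p>0$, $h^p$ is the set of complex-valued harmonic functions $f$ in $\mathbb{D}$ with $\sup_{0<r<1}M_p(r,f)<\infty$, where $M_p(r,f)=\left(\frac{1}{2\pi}\int_0^{2\pi}|f(re^{i\theta})|^p\,d\theta\right)^{1/p}$. On $\mathbb{T}$, $f(e^{i\theta})$ denotes the radial limit $\lim_{r\to1^-}f(re^{i\theta})$, and $\int_{\mathbb{T}}|f(z)|^p|dz|=\int_0^{2\pi}|f(e^{i\theta})|^p\,d\theta$. A convex curve in $\mathbb{D}$ is a curve contained in $\mathbb{D}$, traversed once, that is the boundary of a bounded convex set or an arc of such a boundary; line segments (e.g. the diameter $-1<x<1$) are included. $|dz|$ is arc length. *)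

theory Defs
  imports "HOL-Analysis.Analysis"
begin

text \<open>
  For a real-valued function on an open set: existence of continuous second partial derivatives
  together with the Laplace equation. Here \<open>ux\<close>, \<open>uy\<close> are the first partials and \<open>uxx\<close>,
  \<open>uxy\<close>, \<open>uyy\<close> the second ones; the use of a single mixed partial is justified by the
  symmetry of second derivatives of \<open>C\<^sup>2\<close> functions.
\<close>

definition real_harmonic_on :: "(complex \<Rightarrow> real) \<Rightarrow> complex set \<Rightarrow> bool" where
  "real_harmonic_on u S \<longleftrightarrow>
     (\<exists>ux uy uxx uxy uyy :: complex \<Rightarrow> real.
        (\<forall>z\<in>S. (u has_derivative (\<lambda>h. ux z * Re h + uy z * Im h)) (at z)) \<and>
        (\<forall>z\<in>S. (ux has_derivative (\<lambda>h. uxx z * Re h + uxy z * Im h)) (at z)) \<and>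
        (\<forall>z\<in>S. (uy has_derivative (\<lambda>h. uxy z * Re h + uyy z * Im h)) (at z)) \<and>
        continuous_on S uxx \<and> continuous_on S uxy \<and> continuous_on S uyy \<and>
        (\<forall>z\<in>S. uxx z + uyy z = 0))"

definition complex_harmonic_on :: "(complex \<Rightarrow> complex) \<Rightarrow> complex set \<Rightarrow> bool" where
  "complex_harmonic_on f S \<longleftrightarrow>
     real_harmonic_on (\<lambda>z. Re (f z)) S \<and> real_harmonic_on (\<lambda>z. Im (f z)) S"

definition integral_mean :: "real \<Rightarrow> real \<Rightarrow> (complex \<Rightarrow> complex) \<Rightarrow> real" where
  "integral_mean p r f =
     (1 / (2 * pi) * integral {0..2*pi} (\<lambda>\<theta>. norm (f (rcis r \<theta>)) powr p)) powr (1 / p)"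

definition harmonic_hardy :: "real \<Rightarrow> (complex \<Rightarrow> complex) set" where
  "harmonic_hardy p =
     {f. complex_harmonic_on f (ball 0 1) \<and> bdd_above ((\<lambda>r. integral_mean p r f) ` {0<..<1})}"

definition has_radial_limits_AE :: "(complex \<Rightarrow> complex) \<Rightarrow> bool" where
  "has_radial_limits_AE f \<longleftrightarrow>
     (AE \<theta> in lborel. \<theta> \<in> {0..2*pi} \<longrightarrow> (\<exists>l. ((\<lambda>r. f (rcis r \<theta>)) \<longlongrightarrow> l) (at_left 1)))"

definition radial_limit :: "(complex \<Rightarrow> complex) \<Rightarrow> real \<Rightarrow> complex" where
  "radial_limit f \<theta> = Lim (at_left 1) (\<lambda>r. f (rcis r \<theta>))"

definition circle_integral :: "real \<Rightarrow> (complex \<Rightarrow> complex) \<Rightarrow> ennreal" where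
  "circle_integral p f = (\<integral>\<^sup>+\<theta>\<in>{0..2*pi}. ennreal (norm (radial_limit f \<theta>) powr p) \<partial>lborel)"

text \<open>
  Length of a curve on \<open>[a, b]\<close>: supremum of the lengths of inscribed polygons, the vertices
  being given by increasing lists of parameters.
\<close>

definition curve_length :: "(real \<Rightarrow> complex) \<Rightarrow> real \<Rightarrow> real \<Rightarrow> ennreal" where
  "curve_length \<gamma> a b =
     (SUP ts \<in> {ts. sorted ts \<and> set ts \<subseteq> {a..b}}.
        ennreal (\<Sum>i<length ts - 1. dist (\<gamma> (ts ! i)) (\<gamma> (ts ! Suc i))))"

text \<open>
  Parametrization of \<open>C\<close> by arc length, traversing \<open>C\<close> once. The parameter interval may contain
  none, one or both of its endpoints. Injectivity is demanded only in its interior, so that a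
  closed curve may be parametrized on \<open>[0, L]\<close> with equal values at \<open>0\<close> and \<open>L\<close>.
  Continuity follows from the length condition.
\<close>

definition arc_length_param :: "(real \<Rightarrow> complex) \<Rightarrow> real set \<Rightarrow> complex set \<Rightarrow> bool" where
  "arc_length_param \<gamma> I C \<longleftrightarrow>
     is_interval I \<and> inj_on \<gamma> (interior I) \<and> \<gamma> ` I = C \<and>
     (\<forall>s\<in>I. \<forall>t\<in>I. s \<le> t \<longrightarrow> curve_length \<gamma> s t = ennreal (t - s))"

text \<open>
  Arcs of a boundary are its connected subsets, with or without their endpoints. A line segment
  has empty interior in the plane and hence is its own frontier, so segments are included.
\<close>

definition convex_curve :: "complex set \<Rightarrow> bool" where
  "convex_curve C \<longleftrightarrow>
     (\<exists>S. bounded S \<and> convex S \<and> (C = frontier S \<or> connected C \<and> C \<subseteq> frontier S))"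

definition curve_integral ::
    "real \<Rightarrow> (complex \<Rightarrow> complex) \<Rightarrow> (real \<Rightarrow> complex) \<Rightarrow> real set \<Rightarrow> ennreal" where
  "curve_integral p f \<gamma> I = (\<integral>\<^sup>+s\<in>I. ennreal (norm (f (\<gamma> s)) powr p) \<partial>lborel)"

end

theory Submission
  imports Defs "HOL-Complex_Analysis.Cauchy_Integral_Formula"
begin

text \<open>
  The Poisson kernel is positive and has mean value 1 on every circle about the origin, so it
  lies in \<open>h\<^sup>p\<close> for all \<open>p \<le> 1\<close>; its radial limits vanish at every point of the unit
  circle except 1. The right-hand side of the inequality is therefore 0, while the integral over
  any segment in the disc is positive.
\<close>

definition cayley :: "complex \<Rightarrow> complex" where
  "cayley z = (1 + z) / (1 - z)"

text \<open>The Cayley transform maps the disc onto the right half-plane. Taking the kernel as its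
  real part gives harmonicity and the mean value from holomorphy; \<open>poisson_kernel_eq\<close>
  recovers the usual quotient.\<close>

definition poisson_kernel :: "complex \<Rightarrow> real" where
  "poisson_kernel z = Re (cayley z)"

section \<open>Real parts of holomorphic functions are harmonic\<close>

text \<open>These are the Cauchy-Riemann equations. The second claim is stated for
  \<open>- Im\<close> because the partial derivative of \<open>Re g\<close> in the imaginary
  direction is \<open>- Im (deriv g)\<close>, which has to be differentiated once more.\<close>

lemma has_derivative_Re_Im:
  assumes "(g has_field_derivative d) (at z)"
  shows "((\<lambda>w. Re (g w)) has_derivative (\<lambda>h. Re d * Re h + (- Im d) * Im h)) (at z)"
    and "((\<lambda>w. - Im (g w)) has_derivative (\<lambda>h. (- Im d) * Re h + (- Re d) * Im h)) (at z)"
proof -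
  have g: "(g has_derivative (\<lambda>h. d * h)) (at z)"
    using assms by (simp add: has_field_derivative_def)
  show "((\<lambda>w. Re (g w)) has_derivative (\<lambda>h. Re d * Re h + (- Im d) * Im h)) (at z)"
    using has_derivative_Re[OF g] by simp
  show "((\<lambda>w. - Im (g w)) has_derivative (\<lambda>h. (- Im d) * Re h + (- Re d) * Im h)) (at z)"
    using has_derivative_minus[OF has_derivative_Im[OF g]] by (simp add: algebra_simps)
qed

text \<open>The second partials are \<open>Re\<close>, \<open>- Im\<close> and \<open>- Re\<close>
  of the second complex derivative, so the Laplace equation is the cancellation of the first and the
  last.\<close>

lemma real_harmonic_on_Re:
  assumes "g holomorphic_on S" "open S"
  shows "real_harmonic_on (\<lambda>z. Re (g z)) S"
proof -
  have g': "deriv g holomorphic_on S" and g'': "deriv (deriv g) holomorphic_on S"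
    using assms by (auto intro: holomorphic_deriv)
  have cont: "continuous_on S (\<lambda>z. Re (deriv (deriv g) z))"
    "continuous_on S (\<lambda>z. - Im (deriv (deriv g) z))"
    "continuous_on S (\<lambda>z. - Re (deriv (deriv g) z))"
    by (intro continuous_intros holomorphic_on_imp_continuous_on[OF g''])+
  have "((\<lambda>w. Re (g w)) has_derivative
        (\<lambda>h. Re (deriv g z) * Re h + (- Im (deriv g z)) * Im h)) (at z)"
    and "((\<lambda>w. Re (deriv g w)) has_derivative
        (\<lambda>h. Re (deriv (deriv g) z) * Re h + (- Im (deriv (deriv g) z)) * Im h)) (at z)"
    and "((\<lambda>w. - Im (deriv g w)) has_derivative
        (\<lambda>h. (- Im (deriv (deriv g) z)) * Re h + (- Re (deriv (deriv g) z)) * Im h)) (at z)"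
    if "z \<in> S" for z
    using has_derivative_Re_Im holomorphic_derivI[OF assms that]
      holomorphic_derivI[OF g' assms(2) that] by blast+
  then show ?thesis
    unfolding real_harmonic_on_def using cont
    by (intro exI[where x = "\<lambda>z. Re (deriv g z)"] exI[where x = "\<lambda>z. - Im (deriv g z)"]
        exI[where x = "\<lambda>z. Re (deriv (deriv g) z)"]
        exI[where x = "\<lambda>z. - Im (deriv (deriv g) z)"]
        exI[where x = "\<lambda>z. - Re (deriv (deriv g) z)"] conjI ballI)
      simp_all
qed

section \<open>The Poisson kernel and its membership in the Hardy space\<close>

lemma holomorphic_on_cayley: "1 \<notin> S \<Longrightarrow> cayley holomorphic_on S"
  unfolding cayley_def by (intro holomorphic_intros) auto

lemma poisson_kernel_eq: "poisson_kernel z = (1 - (norm z)\<^sup>2) / (norm (1 - z))\<^sup>2"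
  unfolding poisson_kernel_def cayley_def
  by (simp add: Re_divide cmod_power2) (simp add: field_simps power2_eq_square)

lemma poisson_kernel_nonneg: "norm z \<le> 1 \<Longrightarrow> 0 \<le> poisson_kernel z"
  by (simp add: poisson_kernel_eq power_le_one)

lemma continuous_on_poisson_kernel:
  "1 \<notin> S \<Longrightarrow> continuous_on S poisson_kernel"
  unfolding poisson_kernel_def
  by (intro continuous_intros holomorphic_on_imp_continuous_on holomorphic_on_cayley)

lemma continuous_on_poisson_kernel_circle:
  assumes "\<bar>r\<bar> < 1"
  shows "continuous_on T (\<lambda>\<theta>. poisson_kernel (rcis r \<theta>))"
proof -
  have "continuous_on T (\<lambda>\<theta>. rcis r \<theta>)"
    unfolding rcis_def by (intro continuous_intros)
  moreover have "rcis r \<theta> \<noteq> 1" for \<theta>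
    using assms norm_one by (metis complex_mod_rcis order_less_irrefl)
  ultimately show ?thesis
    by (intro continuous_on_compose2[OF continuous_on_poisson_kernel[of "- {1}"]]) auto
qed

text \<open>Cauchy's formula at the centre, where \<open>cayley 0 = 1\<close>. On the circle dz/z is
  i times the angle differential, so the kernel appears as the imaginary part of
  \<open>\<i> * cayley\<close>.\<close>

lemma poisson_kernel_has_integral:
  assumes "0 < r" "r < 1"
  shows "((\<lambda>\<theta>. poisson_kernel (rcis r \<theta>)) has_integral 2 * pi) {0..2*pi}"
proof -
  have "cayley holomorphic_on cball 0 r"
    using assms by (intro holomorphic_on_cayley) auto
  then have "((\<lambda>u. cayley u / (u - 0)) has_contour_integral 2 * of_real pi * \<i> * cayley 0)
      (circlepath 0 r)"
    using assms by (intro Cauchy_integral_circlepath_simple) auto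
  then have "((\<lambda>t. cayley (r * cis t) / (r * cis t) * r * \<i> * cis t) has_integral
      2 * of_real pi * \<i>) {0..2*pi}"
    by (simp add: circlepath_def has_contour_integral_part_circlepath_iff cayley_def)
  moreover have "cayley (r * cis t) / (r * cis t) * r * \<i> * cis t = \<i> * cayley (rcis r t)" for t
    using assms by (simp add: rcis_def)
  ultimately have "((\<lambda>t. \<i> * cayley (rcis r t)) has_integral 2 * of_real pi * \<i>) {0..2*pi}"
    by (simp only:)
  from has_integral_linear[OF this bounded_linear_Im] show ?thesis
    by (simp add: poisson_kernel_def o_def)
qed

lemma poisson_kernel_in_harmonic_hardy:
  assumes "0 < p" "p \<le> 1"
  shows "(\<lambda>z. complex_of_real (poisson_kernel z)) \<in> harmonic_hardy p"
proof -
  have "real_harmonic_on poisson_kernel (ball 0 1)"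
    unfolding poisson_kernel_def by (intro real_harmonic_on_Re holomorphic_on_cayley) auto
  moreover have "real_harmonic_on (\<lambda>z. 0) (ball 0 1)"
    using real_harmonic_on_Re[of "\<lambda>z. 0" "ball 0 1"] by simp
  \<comment> \<open>The constant 2 is the mean of \<open>1 + P\<close>, which dominates
    \<open>P powr p\<close>: compare with 1 where \<open>P \<le> 1\<close>, and with
    \<open>P\<close> itself elsewhere.\<close>
  moreover have "integral_mean p r (\<lambda>z. complex_of_real (poisson_kernel z)) \<le> 2 powr (1 / p)"
    if "r \<in> {0<..<1}" for r
  proof -
    have r: "0 < r" "r < 1" using that by auto
    define P where "P \<theta> = poisson_kernel (rcis r \<theta>)" for \<theta>
    have P0: "0 \<le> P \<theta>" for \<theta>
      using r unfolding P_def by (intro poisson_kernel_nonneg) auto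
    have "P \<theta> powr p \<le> 1 + P \<theta>" for \<theta>
    proof (cases "P \<theta> \<le> 1")
      case True
      then have "P \<theta> powr p \<le> 1 powr p" using P0 assms by (intro powr_mono2) auto
      then show ?thesis using P0[of \<theta>] by simp
    next
      case False
      then have "P \<theta> powr p \<le> P \<theta> powr 1" using assms by (intro powr_mono) auto
      then show ?thesis using P0[of \<theta>] by simp
    qed
    moreover have "((\<lambda>\<theta>. 1 + P \<theta>) has_integral (2 * pi + 2 * pi)) {0..2*pi}"
      using has_integral_add[OF has_integral_const_real[of "1::real" 0 "2 * pi"]
          poisson_kernel_has_integral[OF r]] by (simp add: P_def)
    moreover have "(\<lambda>\<theta>. P \<theta> powr p) integrable_on {0..2*pi}"
      using assms P0 r unfolding P_def
      by (intro integrable_continuous_real continuous_on_powr' continuous_on_poisson_kernel_circle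
          continuous_on_const) auto
    ultimately have le: "integral {0..2*pi} (\<lambda>\<theta>. P \<theta> powr p) \<le> 2 * pi + 2 * pi"
      by (intro has_integral_le[OF integrable_integral]) auto
    have "integral_mean p r (\<lambda>z. complex_of_real (poisson_kernel z))
        = (1 / (2 * pi) * integral {0..2*pi} (\<lambda>\<theta>. P \<theta> powr p)) powr (1 / p)"
      using P0 by (simp add: integral_mean_def P_def)
    also have "\<dots> \<le> 2 powr (1 / p)"
    proof (rule powr_mono2)
      show "1 / (2 * pi) * integral {0..2*pi} (\<lambda>\<theta>. P \<theta> powr p) \<le> 2"
        using le by (simp add: field_simps)
      show "0 \<le> 1 / (2 * pi) * integral {0..2*pi} (\<lambda>\<theta>. P \<theta> powr p)"
        by (intro mult_nonneg_nonneg Henstock_Kurzweil_Integration.integral_nonneg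
            \<open>(\<lambda>\<theta>. P \<theta> powr p) integrable_on {0..2*pi}\<close>) auto
    qed (use assms in auto)
    finally show ?thesis .
  qed
  ultimately show ?thesis
    unfolding harmonic_hardy_def complex_harmonic_on_def
    by (auto intro!: bdd_aboveI2[where M = "2 powr (1 / p)"])
qed

section \<open>Boundary values on the unit circle\<close>

text \<open>Away from the pole 1 the kernel is continuous across the circle, and there the numerator
  1 - |z|^2 of \<open>poisson_kernel_eq\<close> vanishes.\<close>

lemma poisson_kernel_radial_tendsto:
  assumes "cis \<theta> \<noteq> 1"
  shows "((\<lambda>r. complex_of_real (poisson_kernel (rcis r \<theta>))) \<longlongrightarrow> 0) (at_left 1)"
proof -
  have "((\<lambda>r. rcis r \<theta>) \<longlongrightarrow> rcis 1 \<theta>) (at_left 1)"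
    unfolding rcis_def by (intro tendsto_intros)
  moreover have "isCont poisson_kernel (cis \<theta>)"
    using continuous_on_poisson_kernel[of "- {1}"] assms
      continuous_on_eq_continuous_at[of "- {1}" poisson_kernel]
    by auto
  ultimately have "((\<lambda>r. poisson_kernel (rcis r \<theta>)) \<longlongrightarrow> poisson_kernel (cis \<theta>)) (at_left 1)"
    using isCont_tendsto_compose[of "cis \<theta>" poisson_kernel "\<lambda>r. rcis r \<theta>"] by (simp add: rcis_def)
  then show ?thesis
    by (auto simp: poisson_kernel_eq dest: tendsto_of_real[where 'a = complex])
qed

lemma AE_cis_neq_1: "AE \<theta> in lborel. \<theta> \<in> {0..2*pi} \<longrightarrow> cis \<theta> \<noteq> 1"
proof -
  have endpoint: "\<theta> = 0 \<or> \<theta> = 2 * pi" if "\<theta> \<in> {0..2*pi}" "cis \<theta> = 1" for \<theta>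
  proof -
    from that(2) have "cos \<theta> = 1" by (metis cis.simps(1) one_complex.simps(1))
    then obtain n :: int where n: "\<theta> = of_int n * (2 * pi)"
      by (auto simp: cos_one_2pi_int mult.assoc)
    with that(1) have "0 \<le> real_of_int n * (2 * pi)" "real_of_int n * (2 * pi) \<le> 1 * (2 * pi)"
      by auto
    then have "0 \<le> n" "n \<le> 1"
      by (simp_all only: zero_le_mult_iff mult_le_cancel_right) (use pi_gt_zero in auto)
    then have "n = 0 \<or> n = 1" by linarith
    with n show ?thesis by auto
  qed
  have "AE \<theta> in lborel. \<theta> \<noteq> 0" "AE \<theta> in lborel. \<theta> \<noteq> 2 * pi"
    by (rule AE_lborel_singleton)+
  then show ?thesis by eventually_elim (use endpoint in blast)
qed

lemma poisson_kernel_has_radial_limits_AE: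
  "has_radial_limits_AE (\<lambda>z. complex_of_real (poisson_kernel z))"
  unfolding has_radial_limits_AE_def
  using AE_cis_neq_1 by eventually_elim (blast intro: poisson_kernel_radial_tendsto)

text \<open>At the angles 0 and 2 pi the kernel blows up along the radius and \<open>Lim\<close>
  returns an unspecified value; these two angles form a null set.\<close>

lemma circle_integral_poisson_kernel:
  "circle_integral p (\<lambda>z. complex_of_real (poisson_kernel z)) = 0"
proof -
  have "AE \<theta> in lborel. ennreal (norm (radial_limit (\<lambda>z. complex_of_real (poisson_kernel z)) \<theta>) powr p)
      * indicator {0..2*pi} \<theta> = 0"
    using AE_cis_neq_1
  proof eventually_elim
    case (elim \<theta>)
    then show ?case
      using tendsto_Lim[OF _ poisson_kernel_radial_tendsto[of \<theta>]]
      by (auto simp: radial_limit_def indicator_def)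
  qed
  then show ?thesis
    unfolding circle_integral_def by (subst nn_integral_cong_AE[where v = "\<lambda>_. 0"]) auto
qed

section \<open>Real segments as convex curves parametrized by arc length\<close>

lemma sum_dist_sorted:
  assumes "sorted ts" "set ts \<subseteq> {a..b}" "a \<le> b"
  shows "(\<Sum>i<length ts - 1. dist (complex_of_real (ts ! i)) (complex_of_real (ts ! Suc i))) \<le> b - a"
\<comment> \<open>The telescoped sum needs a first and a last entry. For the empty list
  \<open>length ts - 1\<close> is 0 by truncated subtraction, the sum is empty, and
  \<open>a \<le> b\<close> gives the bound.\<close>
proof (cases "ts = []")
  case False
  have "(\<Sum>i<length ts - 1. dist (complex_of_real (ts ! i)) (complex_of_real (ts ! Suc i)))
      = (\<Sum>i<length ts - 1. ts ! Suc i - ts ! i)"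
    using sorted_nth_mono[OF assms(1)]
    by (intro sum.cong refl) (simp add: dist_norm abs_minus_commute flip: of_real_diff)
  also have "\<dots> = ts ! (length ts - 1) - ts ! 0"
    by (rule sum_lessThan_telescope)
  also have "\<dots> \<le> b - a"
  proof -
    have "ts ! (length ts - 1) \<in> set ts" "ts ! 0 \<in> set ts"
      using False by (auto intro!: nth_mem)
    with assms(2) have "ts ! (length ts - 1) \<in> {a..b}" "ts ! 0 \<in> {a..b}" by blast+
    then show ?thesis by simp
  qed
  finally show ?thesis .
qed (use assms in auto)

lemma curve_length_of_real:
  assumes "a \<le> b"
  shows "curve_length complex_of_real a b = ennreal (b - a)"
  unfolding curve_length_def
proof (rule antisym)
  show "(SUP ts \<in> {ts. sorted ts \<and> set ts \<subseteq> {a..b}}.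
      ennreal (\<Sum>i<length ts - 1. dist (complex_of_real (ts ! i)) (complex_of_real (ts ! Suc i)))) \<le> ennreal (b - a)"
    using assms by (intro SUP_least ennreal_leI sum_dist_sorted) auto
  show "ennreal (b - a) \<le> (SUP ts \<in> {ts. sorted ts \<and> set ts \<subseteq> {a..b}}.
      ennreal (\<Sum>i<length ts - 1. dist (complex_of_real (ts ! i)) (complex_of_real (ts ! Suc i))))"
    \<comment> \<open>The polygon with only the two end points as vertices already attains the full
      length.\<close>
    using assms by (intro SUP_upper2[of "[a, b]"]) (auto simp: dist_norm simp flip: of_real_diff)
qed

lemma arc_length_param_of_real:
  "is_interval I \<Longrightarrow> arc_length_param complex_of_real I (complex_of_real ` I)"
  by (simp add: arc_length_param_def curve_length_of_real inj_on_def)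

text \<open>The segment itself serves as the convex set: its interior is empty because the plane has
  dimension 2, so the segment lies in its own frontier, and it is connected.\<close>

lemma convex_curve_closed_segment: "convex_curve (closed_segment a b)"
proof -
  have "interior (closed_segment a b) = {}"
    by (simp add: interior_closed_segment_ge2)
  then have "closed_segment a b \<subseteq> frontier (closed_segment a b)"
    by (simp add: frontier_def)
  then show ?thesis
    unfolding convex_curve_def by (intro exI[of _ "closed_segment a b"]) (auto simp: bounded_closed_segment)
qed

theorem theorem2:
  fixes p :: real
  assumes "0 < p" and "p \<le> 1"
  shows "\<not> (\<exists>K :: ennreal. K < \<infinity> \<and>
           (\<forall>f C \<gamma> I. f \<in> harmonic_hardy p \<longrightarrow> has_radial_limits_AE f \<longrightarrow>
              convex_curve C \<longrightarrow> C \<subseteq> ball 0 1 \<longrightarrow> arc_length_param \<gamma> I C \<longrightarrow>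
              curve_integral p f \<gamma> I \<le> K * circle_integral p f))"
proof
  assume "\<exists>K :: ennreal. K < \<infinity> \<and>
           (\<forall>f C \<gamma> I. f \<in> harmonic_hardy p \<longrightarrow> has_radial_limits_AE f \<longrightarrow>
              convex_curve C \<longrightarrow> C \<subseteq> ball 0 1 \<longrightarrow> arc_length_param \<gamma> I C \<longrightarrow>
              curve_integral p f \<gamma> I \<le> K * circle_integral p f)"
  then obtain K :: ennreal where K: "\<And>f C \<gamma> I. f \<in> harmonic_hardy p \<Longrightarrow> has_radial_limits_AE f \<Longrightarrow>
      convex_curve C \<Longrightarrow> C \<subseteq> ball 0 1 \<Longrightarrow> arc_length_param \<gamma> I C \<Longrightarrow>
      curve_integral p f \<gamma> I \<le> K * circle_integral p f"
    by blast
  \<comment> \<open>The curve lies on the radius towards the pole, where the kernel equals (1 + s) /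
    (1 - s) and is thus at least 1; stopping at 1/2 keeps it inside the disc.\<close>
  let ?f = "\<lambda>z. complex_of_real (poisson_kernel z)" and ?I = "{0..1/2::real}"
  have C: "complex_of_real ` ?I = closed_segment 0 (1/2)"
    using closed_segment_of_real[of 0 "1/2", where ?'a = complex]
    by (simp add: closed_segment_eq_real_ivl)
  have "curve_integral p ?f complex_of_real ?I \<le> K * circle_integral p ?f"
  proof (rule K)
    show "convex_curve (complex_of_real ` ?I)"
      unfolding C by (rule convex_curve_closed_segment)
    show "complex_of_real ` ?I \<subseteq> ball 0 1"
      by auto
  qed (use assms in \<open>auto intro: poisson_kernel_in_harmonic_hardy
        poisson_kernel_has_radial_limits_AE arc_length_param_of_real is_interval_cc\<close>)
  then have "curve_integral p ?f complex_of_real ?I = 0"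
    by (simp add: circle_integral_poisson_kernel)
  \<comment> \<open>The lower bound is the length of the segment, since the integrand is at least 1
    on it.\<close>
  moreover have "ennreal (1 / 2) \<le> curve_integral p ?f complex_of_real ?I"
  proof -
    have "1 \<le> norm (?f (complex_of_real s)) powr p" if "s \<in> ?I" for s
    proof -
      have "cayley (complex_of_real s) = complex_of_real ((1 + s) / (1 - s))"
        by (simp add: cayley_def)
      then have "poisson_kernel (complex_of_real s) = (1 + s) / (1 - s)"
        unfolding poisson_kernel_def by (simp only: Re_complex_of_real)
      then have "1 \<le> poisson_kernel (complex_of_real s)"
        using that by simp
      then show ?thesis
        using assms by (simp add: ge_one_powr_ge_zero)
    qed
    then have "(\<integral>\<^sup>+s. indicator ?I s \<partial>lborel) \<le> curve_integral p ?f complex_of_real ?I"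
      unfolding curve_integral_def
      by (intro nn_integral_mono) (auto simp: indicator_def)
    then show ?thesis by simp
  qed
  ultimately show False by simp
qed

end
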